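(* Let $p\ge1$ and let $\{K_t\}_t\subset\mathcal{K}_{sym}$ be a solution of the contracting $p$-centro affine flow $\frac{\partial}{\partial t}s=-s^{1-\frac{3p}{p+2}}\mathfrak r^{-\frac{p}{p+2}}$; write $\gamma=\partial K_t$, $A=A(K_t)$, $\Omega_p=\Omega_p(t)=\Omega_p(K_t)$. Then, as long as the solution exists, the following hold. If $1\le p\le 2$, then $$\frac{d}{dt}\Omega_p(t)\ge\frac{p-2}{p+2}\frac{\Omega_p^2}{A}+\frac{18(p-1)p^2}{(p+2)^3}\int_{\gamma}\sigma^{-\frac{6p}{p+2}}\sigma_{\mathfrak s}^2\,d\mathfrak s,$$ while if $p\ge2$, then $$\frac{d}{dt}\Omega_p(t)\ge\frac{p-2}{p+2}\frac{\Omega_p^2}{A}+\frac{18p^2}{(p+2)^3}\int_{\gamma}\sigma^{-\frac{6p}{p+2}}\sigma_{\mathfrak s}^2\,d\mathfrak s.$$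
   Context: $\mathcal{K}_{sym}$ denotes the set of compact, strictly convex bodies $K\subset\mathbb{R}^2$, centrally symmetric about the origin, that are smoothly embedded, i.e. whose Gauss parametrization (by the outward unit normal $z=(\cos\theta,\sin\theta)$) is a smooth embedding of $\mathbb{S}^1$; in particular the curvature $\kappa$ of the boundary is positive. $s$ is the support function and $\mathfrak r=1/\kappa=s_{\theta\theta}+s$ the radius of curvature, as functions of the normal angle $\theta\in\mathbb{S}^1$. $A(K)=\frac12\int_{\mathbb{S}^1}\frac{s}{\kappa}d\theta$ is the area and $\Omega_p(K)=\int_{\mathbb{S}^1}\frac{s}{\kappa}\left(\frac{\kappa}{s^3}\right)^{\frac{p}{p+2}}d\theta$ is the $p$-affine length. For a counterclockwise parametrized curve $\gamma$ with parameter $u$, $\mathfrak s$ denotes the affine arc-length, $d\mathfrak s=[\gamma_u,\gamma_{uu}]^{1/3}du$, where $[u,v]$ is the determinant of the matrix with rows $u,v\in\mathbb{R}^2$, and a subscript $\mathfrak s$ denotes differentiation with respect to $\mathfrak s$. The affine support function is $\sigma=\left(\frac{\kappa}{s^3}\right)^{-1/3}=[\gamma,\gamma_{\mathfrak s}]$. *)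

theory Defs
  imports "HOL-Analysis.Analysis"
begin

definition bracket :: "real^2 \<Rightarrow> real^2 \<Rightarrow> real" where
  "bracket u v = det (vector [u, v] :: real^2^2)"

definition normal_vec :: "real \<Rightarrow> real^2" where
  "normal_vec \<theta> = vector [cos \<theta>, sin \<theta>]"

abbreviation vderiv :: "(real \<Rightarrow> real^2) \<Rightarrow> real \<Rightarrow> real^2" where
  "vderiv \<gamma> \<equiv> \<lambda>u. vector_derivative \<gamma> (at u)"

definition smooth_curve :: "(real \<Rightarrow> real^2) \<Rightarrow> bool" where
  "smooth_curve \<gamma> \<longleftrightarrow> (\<forall>k u. (vderiv ^^ k) \<gamma> differentiable (at u))"

definition curvature :: "(real \<Rightarrow> real^2) \<Rightarrow> real \<Rightarrow> real" where
  "curvature \<gamma> u = bracket (vderiv \<gamma> u) (vderiv (vderiv \<gamma>) u) / norm (vderiv \<gamma> u) ^ 3"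


text \<open>Functions on the circle are rendered as functions of the normal angle \<open>\<theta>\<close>;
  they are \<open>2\<pi>\<close>-periodic because they depend on \<open>\<theta>\<close> only through \<open>normal_vec \<theta>\<close>.\<close>

definition support :: "(real^2) set \<Rightarrow> real \<Rightarrow> real" where
  "support K \<theta> = Sup ((\<lambda>x. x \<bullet> normal_vec \<theta>) ` K)"

text \<open>The boundary point with outward normal \<open>normal_vec \<theta>\<close>; it is unique for compact
  strictly convex bodies.\<close>

definition gauss_param :: "(real^2) set \<Rightarrow> real \<Rightarrow> real^2" where
  "gauss_param K \<theta> = (THE x. x \<in> frontier K \<and> (\<forall>y\<in>K. (y - x) \<bullet> normal_vec \<theta> \<le> 0))"

definition strictly_convex_body :: "(real^2) set \<Rightarrow> bool" where
  "strictly_convex_body K \<longleftrightarrow> compact K \<and> convex K \<and> interior K \<noteq> {} \<and>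
     (\<forall>x\<in>K. \<forall>y\<in>K. x \<noteq> y \<longrightarrow> open_segment x y \<subseteq> interior K)"

text \<open>By compactness of the circle, a smooth embedding of it is the same as a smooth injective
  immersion.\<close>

definition K_sym :: "(real^2) set set" where
  "K_sym = {K. strictly_convex_body K \<and> uminus ` K = K \<and>
     smooth_curve (gauss_param K) \<and>
     inj_on (gauss_param K) {0..<2*pi} \<and>
     (\<forall>\<theta>. vderiv (gauss_param K) \<theta> \<noteq> 0)}"

definition kappa :: "(real^2) set \<Rightarrow> real \<Rightarrow> real" where
  "kappa K = curvature (gauss_param K)"

definition curv_radius :: "(real^2) set \<Rightarrow> real \<Rightarrow> real" where
  "curv_radius K \<theta> = 1 / kappa K \<theta>"

definition area :: "(real^2) set \<Rightarrow> real" where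
  "area K = 1/2 * integral {0..2*pi} (\<lambda>\<theta>. support K \<theta> / kappa K \<theta>)"

definition Omega :: "real \<Rightarrow> (real^2) set \<Rightarrow> real" where
  "Omega p K = integral {0..2*pi}
     (\<lambda>\<theta>. support K \<theta> / kappa K \<theta> * (kappa K \<theta> / support K \<theta> ^ 3) powr (p / (p + 2)))"


text \<open>Affine notions for a counterclockwise curve \<open>\<gamma>\<close> with arbitrary parameter \<open>u\<close>:
  \<open>affine_speed\<close> is the density of the affine arc-length with respect to \<open>du\<close>, so the
  derivative of \<open>f\<close> with respect to affine arc-length is \<open>f\<^sub>u\<close> divided by it.\<close>

definition affine_speed :: "(real \<Rightarrow> real^2) \<Rightarrow> real \<Rightarrow> real" where
  "affine_speed \<gamma> u = bracket (vderiv \<gamma> u) (vderiv (vderiv \<gamma>) u) powr (1/3)"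

definition affine_deriv ::
  "(real \<Rightarrow> real^2) \<Rightarrow> (real \<Rightarrow> 'a::real_normed_vector) \<Rightarrow> real \<Rightarrow> 'a" where
  "affine_deriv \<gamma> f u = vector_derivative f (at u) /\<^sub>R affine_speed \<gamma> u"

definition affine_support :: "(real \<Rightarrow> real^2) \<Rightarrow> real \<Rightarrow> real" where
  "affine_support \<gamma> u = bracket (\<gamma> u) (affine_deriv \<gamma> \<gamma> u)"

text \<open>Integral with respect to affine arc-length over a closed curve with parameter interval
  \<open>[0, 2\<pi>]\<close>.\<close>

definition affine_integral :: "(real \<Rightarrow> real^2) \<Rightarrow> (real \<Rightarrow> real) \<Rightarrow> real" where
  "affine_integral \<gamma> f = integral {0..2*pi} (\<lambda>u. f u * affine_speed \<gamma> u)"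


text \<open>\<open>C\<^sup>k\<close> regularity of \<open>f \<theta> t\<close> on \<open>\<real> \<times> I\<close>; at an endpoint of \<open>I\<close>, the \<open>t\<close>-derivative is
  one-sided.\<close>

primrec Ck_on :: "nat \<Rightarrow> real set \<Rightarrow> (real \<Rightarrow> real \<Rightarrow> real) \<Rightarrow> bool" where
  "Ck_on 0 I f \<longleftrightarrow> continuous_on (UNIV \<times> I) (\<lambda>(\<theta>, t). f \<theta> t)"
| "Ck_on (Suc k) I f \<longleftrightarrow> continuous_on (UNIV \<times> I) (\<lambda>(\<theta>, t). f \<theta> t) \<and>
     (\<exists>f_\<theta> f_t.
        (\<forall>\<theta>. \<forall>t\<in>I. ((\<lambda>\<theta>. f \<theta> t) has_real_derivative f_\<theta> \<theta> t) (at \<theta>) \<and>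
                    (f \<theta> has_real_derivative f_t \<theta> t) (at t within I)) \<and>
        Ck_on k I f_\<theta> \<and> Ck_on k I f_t)"

text \<open>Solutions on the time interval \<open>[0, T)\<close> are classical: the support function is smooth
  jointly in \<open>\<theta>\<close> and \<open>t\<close>, up to the initial time.\<close>

definition contracting_flow :: "real \<Rightarrow> real \<Rightarrow> (real \<Rightarrow> (real^2) set) \<Rightarrow> bool" where
  "contracting_flow p T K \<longleftrightarrow>
     (\<forall>t\<in>{0..<T}. K t \<in> K_sym) \<and>
     (\<forall>k. Ck_on k {0..<T} (\<lambda>\<theta> t. support (K t) \<theta>)) \<and>
     (\<forall>\<theta>. \<forall>t\<in>{0..<T}. ((\<lambda>\<tau>. support (K \<tau>) \<theta>) has_real_derivative
        - (support (K t) \<theta> powr (1 - 3 * p / (p + 2)) *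
           curv_radius (K t) \<theta> powr (- p / (p + 2)))) (at t within {0..<T}))"

end

theory Submission
  imports Defs
begin

text \<open>
  Put \<open>m = p/(p + 2)\<close>.  In the normal angle, the flow is \<open>s\<^sub>t = - F\<close> with
  \<open>F = s\<^sup>1\<^sup>-\<^sup>3\<^sup>m r\<^sup>-\<^sup>m\<close>, the radius of curvature \<open>r = s'' + s\<close> evolves by \<open>r\<^sub>t = - (F'' + F)\<close>, and
  \<open>\<Omega>\<^sub>p = \<integral> s\<^sup>1\<^sup>-\<^sup>3\<^sup>m r\<^sup>1\<^sup>-\<^sup>m = \<integral> F r\<close>.  Differentiating under the integral sign and integrating by
  parts gives an exact formula,
  \<open>d\<Omega>\<^sub>p/dt = (1 - m) P + (4 m - 2) J\<close> with \<open>P = \<integral> s\<^sup>2 g'\<^sup>2\<close>, \<open>J = \<integral> s r g\<^sup>2\<close> and \<open>g = F/s\<close>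
  (\<open>Omega_derivative\<close>, \<open>energy_identities\<close>).  As \<open>g\<close> is the power \<open>\<sigma>\<^sup>-\<^sup>3\<^sup>m\<close> of the affine support
  function, \<open>P\<close> is \<open>9 m\<^sup>2\<close> times the affine integral of the statement (\<open>affine_integral_eq\<close>), and
  \<open>9 m\<^sup>2 (1 - m) = 18 p\<^sup>2/(p + 2)\<^sup>3\<close> is its coefficient for \<open>p \<ge> 2\<close>.

  It remains to compare \<open>J\<close> with \<open>\<Omega>\<^sub>p\<^sup>2/(2 A)\<close>, where \<open>2 A = \<integral> s r\<close>.  For \<open>p \<ge> 2\<close> the coefficient
  \<open>4 m - 2\<close> of \<open>J\<close> is nonnegative and the Cauchy-Schwarz inequality \<open>J \<ge> \<Omega>\<^sub>p\<^sup>2/(2 A)\<close> is what is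
  needed (\<open>cauchy_schwarz_weighted\<close>).  For \<open>p \<le> 2\<close> it is nonpositive, and a reverse inequality is
  needed: \<open>J \<le> \<Omega>\<^sub>p\<^sup>2/(2 A) + P\<close>.  As \<open>J - P = \<integral> F\<^sup>2 - F'\<^sup>2\<close>, this is Minkowski's inequality for the
  mixed areas of \<open>s\<close> and \<open>F\<close>.  Central symmetry makes it elementary (\<open>minkowski_symmetric\<close>): after
  subtracting the multiple of \<open>s\<close> that makes \<open>F\<close> vanish at \<open>0\<close>, and hence at \<open>\<pi>\<close> and \<open>2\<pi>\<close>, it
  reduces to the Wirtinger inequality on intervals of length \<open>\<pi>\<close> with Dirichlet boundary values.

  The rest justifies the calculus: \<open>K_sym_geometry\<close> derives the formulas for \<open>s\<close>, \<open>r\<close> and the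
  brackets from the geometric definitions, and \<open>contracting_flow_evolution\<close> derives the equation for
  \<open>r\<^sub>t\<close>, which rests on exchanging time and angle derivatives.
\<close>

section \<open>Integral inequalities on the circle\<close>

lemma DERIV_periodic:
  fixes f f' :: "real \<Rightarrow> real"
  assumes d: "\<And>x. (f has_real_derivative f' x) (at x)" and per: "\<And>x. f (x + c) = f x"
  shows "f' (x + c) = f' x"
proof -
  have "((\<lambda>y. f (y + c)) has_real_derivative f' (x + c)) (at x)"
    using d DERIV_shift by blast
  then have "(f has_real_derivative f' (x + c)) (at x)"
    by (simp add: per)
  then show ?thesis using d DERIV_unique by blast
qed

lemma integral_deriv_periodic:
  fixes f f' :: "real \<Rightarrow> real"
  assumes d: "\<And>x. (f has_real_derivative f' x) (at x)" and "f b = f a" "a \<le> b"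
  shows "(f' has_integral 0) {a..b}"
proof -
  have "(f' has_integral (f b - f a)) {a..b}"
    using assms by (intro fundamental_theorem_of_calculus)
      (auto simp: has_real_derivative_iff_has_vector_derivative[symmetric]
            intro: has_field_derivative_at_within)
  then show ?thesis using assms by simp
qed

lemma continuous_UNIV_integrable:
  fixes h :: "real \<Rightarrow> real"
  shows "continuous_on UNIV h \<Longrightarrow> h integrable_on {a..b}"
  by (meson continuous_on_subset integrable_continuous_interval subset_UNIV)

text \<open>For \<open>0 < k < 1\<close> the function \<open>w(x) = sin (k (x - a) + (1 - k) \<pi>/2)\<close> solves \<open>w'' = - k\<^sup>2 w\<close>
  and is positive on the closed interval \<open>[a, a + \<pi>]\<close>, so Picone's identity
  \<open>u'\<^sup>2 - k\<^sup>2 u\<^sup>2 = (u' - u w'/w)\<^sup>2 + (u\<^sup>2 w'/w)'\<close> holds up to the endpoints, where \<open>u = 0\<close> kills the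
  boundary term.  With \<open>k = 1\<close> at once, \<open>w'/w\<close> would be singular there; instead the factor \<open>k\<^sup>2\<close> is
  removed by letting it tend to \<open>1\<close>.\<close>

lemma wirtinger_dirichlet:
  fixes u u' :: "real \<Rightarrow> real"
  assumes d: "\<And>x. (u has_real_derivative u' x) (at x)"
    and c: "continuous_on UNIV u'" and z: "u a = 0" "u (a + pi) = 0"
  shows "integral {a..a+pi} (\<lambda>x. (u x)\<^sup>2) \<le> integral {a..a+pi} (\<lambda>x. (u' x)\<^sup>2)"
proof (rule field_le_mult_one_interval)
  fix q :: real assume q: "0 < q" "q < 1"
  define k where "k = sqrt q"
  have k: "0 < k" "k < 1" and kq: "k\<^sup>2 = q" using q by (auto simp: k_def)
  define \<phi> where "\<phi> x = k * (x - a) + (1 - k) * pi / 2" for x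
  have \<phi>: "0 < \<phi> x \<and> \<phi> x < pi" if x: "x \<in> {a..a+pi}" for x
  proof -
    have "0 \<le> k * (x - a)" "k * (x - a) \<le> k * pi" using x k by (auto intro: mult_left_mono)
    moreover have "0 < (1 - k) * pi / 2" using k by simp
    moreover have "k * pi + (1 - k) * pi / 2 + (1 - k) * pi / 2 = pi" by (simp add: field_simps)
    ultimately show ?thesis unfolding \<phi>_def by linarith
  qed
  have cu: "continuous_on UNIV u" using d DERIV_isCont continuous_at_imp_continuous_on by blast
  define G where "G x = k * (u x)\<^sup>2 * cot (\<phi> x)" for x
  define g where "g x = 2 * k * u x * u' x * cot (\<phi> x) - k\<^sup>2 * (u x)\<^sup>2 * inverse ((sin (\<phi> x))\<^sup>2)" for x
  \<comment> \<open>\<open>g\<close> is the derivative of \<open>G = u\<^sup>2 w'/w\<close>, where \<open>w = sin \<circ> \<phi>\<close>.\<close>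
  have "(G has_real_derivative g x) (at x)" if x: "x \<in> {a..a+pi}" for x
  proof -
    have s: "sin (\<phi> x) \<noteq> 0" using \<phi>[OF x] sin_gt_zero by fastforce
    have "(\<phi> has_real_derivative k) (at x)"
      unfolding \<phi>_def by (auto intro!: derivative_eq_intros)
    from DERIV_chain2[OF DERIV_cot[OF s] this]
    have "((\<lambda>x. cot (\<phi> x)) has_real_derivative - inverse ((sin (\<phi> x))\<^sup>2) * k) (at x)" .
    then show ?thesis unfolding G_def g_def
      by (auto intro!: derivative_eq_intros d simp: power2_eq_square)
  qed
  then have "(g has_integral (G (a + pi) - G a)) {a..a+pi}"
    by (intro fundamental_theorem_of_calculus)
      (auto simp: has_real_derivative_iff_has_vector_derivative[symmetric]
            intro: has_field_derivative_at_within)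
  then have g: "(g has_integral 0) {a..a+pi}" by (simp add: G_def z)
  have i1: "(\<lambda>x. (u' x)\<^sup>2) integrable_on {a..a+pi}" "(\<lambda>x. (u x)\<^sup>2) integrable_on {a..a+pi}"
    by (intro integrable_continuous_interval continuous_intros continuous_on_subset[OF c]
          continuous_on_subset[OF cu]; simp)+
  have le: "g x \<le> (u' x)\<^sup>2 - q * (u x)\<^sup>2" if x: "x \<in> {a..a+pi}" for x
  proof -
    have s: "sin (\<phi> x) \<noteq> 0" using \<phi>[OF x] sin_gt_zero by fastforce
    have "inverse ((sin (\<phi> x))\<^sup>2) = 1 + (cot (\<phi> x))\<^sup>2"
      using s sin_cos_squared_add[of "\<phi> x"] by (simp add: cot_def field_simps)
    then have "(u' x)\<^sup>2 - q * (u x)\<^sup>2 - g x = (u' x - k * u x * cot (\<phi> x))\<^sup>2"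
      unfolding g_def kq[symmetric] by (simp only:) (simp add: power2_eq_square algebra_simps)
    then show ?thesis by (metis diff_ge_0_iff_ge zero_le_power2)
  qed
  have "((\<lambda>x. (u' x)\<^sup>2 - q * (u x)\<^sup>2) has_integral
      (integral {a..a+pi} (\<lambda>x. (u' x)\<^sup>2) - q * integral {a..a+pi} (\<lambda>x. (u x)\<^sup>2))) {a..a+pi}"
    using i1 by (intro has_integral_diff has_integral_mult_right) (auto simp: integrable_integral)
  from has_integral_le[OF g this] le
  show "q * integral {a..a+pi} (\<lambda>x. (u x)\<^sup>2) \<le> integral {a..a+pi} (\<lambda>x. (u' x)\<^sup>2)"
    by auto
qed

text \<open>This is Minkowski's inequality \<open>A(K, F)\<^sup>2 \<ge> A(K) A(F, F)\<close> for mixed areas, where \<open>s\<close> is the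
  support function of \<open>K\<close>, \<open>s + s''\<close> its radius of curvature and \<open>F\<close> an arbitrary symmetric
  function.  The form \<open>Q(u) = \<integral> u\<^sup>2 - u'\<^sup>2\<close>, twice \<open>A(u, u)\<close>, is nonpositive on
  symmetric functions that vanish at \<open>0\<close>: they vanish at \<open>\<pi>\<close> and \<open>2\<pi>\<close> too, so the Wirtinger
  inequality applies on both halves of the circle.  The function \<open>u = F - k s\<close> with
  \<open>k = F(0)/s(0)\<close> is of this kind, and \<open>Q(F - k s) \<le> 0\<close> bounds \<open>Q(F)\<close> by a quadratic polynomial in \<open>k\<close>
  whose maximum over all \<open>k\<close> is the claimed bound.\<close>

lemma minkowski_symmetric:
  fixes s s' s'' F F' :: "real \<Rightarrow> real"
  assumes s: "\<And>x. (s has_real_derivative s' x) (at x)"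
    and s': "\<And>x. (s' has_real_derivative s'' x) (at x)"
    and F: "\<And>x. (F has_real_derivative F' x) (at x)"
    and c: "continuous_on UNIV s''" "continuous_on UNIV F'"
    and per: "\<And>x. s (x + pi) = s x" "\<And>x. F (x + pi) = F x"
    and s0: "s 0 \<noteq> 0"
    and pos: "0 \<le> integral {0..2*pi} (\<lambda>x. s x * (s x + s'' x))"
  shows "integral {0..2*pi} (\<lambda>x. (F x)\<^sup>2 - (F' x)\<^sup>2) * integral {0..2*pi} (\<lambda>x. s x * (s x + s'' x))
    \<le> (integral {0..2*pi} (\<lambda>x. F x * (s x + s'' x)))\<^sup>2"
proof -
  define k where "k = F 0 / s 0"
  define u where "u x = F x - k * s x" for x
  define u' where "u' x = F' x - k * s' x" for x
  have du: "(u has_real_derivative u' x) (at x)" for x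
    unfolding u_def u'_def by (auto intro!: derivative_eq_intros s F)
  have cs: "continuous_on UNIV s" "continuous_on UNIV s'" "continuous_on UNIV F" "continuous_on UNIV u"
    by (fact DERIV_continuous_on[OF s] DERIV_continuous_on[OF s'] DERIV_continuous_on[OF F]
        DERIV_continuous_on[OF du])+
  have cu': "continuous_on UNIV u'" unfolding u'_def by (intro continuous_intros c cs)
  note int = continuous_UNIV_integrable
  have per2: "s (2 * pi) = s 0" "F (2 * pi) = F 0" "s' (2 * pi) = s' 0" "s pi = s 0" "F pi = F 0"
    using per[of 0] per[of pi] DERIV_periodic[OF s per(1), of 0] DERIV_periodic[OF s per(1), of pi]
    by auto
  have z: "u 0 = 0" "u pi = 0" "u (pi + pi) = 0"
    using s0 per2 by (auto simp: u_def k_def)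
  have split: "integral {0..2*pi} h = integral {0..pi} h + integral {pi..2*pi} h"
    if "continuous_on UNIV h" for h :: "real \<Rightarrow> real"
    using Henstock_Kurzweil_Integration.integral_combine[where a = 0 and c = pi and b = "2*pi" and f = h] int[OF that]
    by simp
  have cu2: "continuous_on UNIV (\<lambda>x. (u x)\<^sup>2)" "continuous_on UNIV (\<lambda>x. (u' x)\<^sup>2)"
    by (intro continuous_intros cs cu')+
  have w: "integral {0..2*pi} (\<lambda>x. (u x)\<^sup>2) \<le> integral {0..2*pi} (\<lambda>x. (u' x)\<^sup>2)"
    using wirtinger_dirichlet[OF du cu', of 0] wirtinger_dirichlet[OF du cu', of pi] z
    unfolding split[OF cu2(1)] split[OF cu2(2)] by simp
  let ?X = "integral {0..2*pi} (\<lambda>x. (F x)\<^sup>2 - (F' x)\<^sup>2)"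
  let ?B = "integral {0..2*pi} (\<lambda>x. s x * (s x + s'' x))"
  let ?O = "integral {0..2*pi} (\<lambda>x. F x * (s x + s'' x))"
  define h where "h x = (-2 * k * F x + k\<^sup>2 * s x) * s' x" for x
  define h' where "h' x = (-2 * k * F' x + k\<^sup>2 * s' x) * s' x + (-2 * k * F x + k\<^sup>2 * s x) * s'' x" for x
  have "(h has_real_derivative h' x) (at x)" for x
    unfolding h_def h'_def by (auto intro!: derivative_eq_intros s s' F)
  then have h: "(h' has_integral 0) {0..2*pi}"
    by (rule integral_deriv_periodic) (auto simp: h_def per2)
  \<comment> \<open>Polarizing \<open>\<integral> u'\<^sup>2 - u\<^sup>2\<close>: integration by parts, through the exact derivative \<open>h'\<close>, turns the
    cross terms into integrals against \<open>s + s''\<close>.\<close>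
  have 1: "((\<lambda>x. (u' x)\<^sup>2 - (u x)\<^sup>2) has_integral
      (integral {0..2*pi} (\<lambda>x. (u' x)\<^sup>2) - integral {0..2*pi} (\<lambda>x. (u x)\<^sup>2))) {0..2*pi}"
    by (intro has_integral_diff integrable_integral int cu2)
  have "((\<lambda>x. - ((F x)\<^sup>2 - (F' x)\<^sup>2) + (2 * k) * (F x * (s x + s'' x)) - k\<^sup>2 * (s x * (s x + s'' x)) + h' x)
      has_integral (- ?X + (2 * k) * ?O - k\<^sup>2 * ?B + 0)) {0..2*pi}"
    by (intro has_integral_add has_integral_diff has_integral_neg has_integral_mult_right
          integrable_integral int continuous_intros cs c h)
  also have "(\<lambda>x. - ((F x)\<^sup>2 - (F' x)\<^sup>2) + (2 * k) * (F x * (s x + s'' x)) - k\<^sup>2 * (s x * (s x + s'' x)) + h' x)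
    = (\<lambda>x. (u' x)\<^sup>2 - (u x)\<^sup>2)"
    by (auto simp: u_def u'_def h'_def power2_eq_square algebra_simps)
  finally have 2: "((\<lambda>x. (u' x)\<^sup>2 - (u x)\<^sup>2) has_integral
      (- ?X + (2 * k) * ?O - k\<^sup>2 * ?B + 0)) {0..2*pi}" .
  have "?X \<le> 2 * k * ?O - k\<^sup>2 * ?B" using has_integral_unique[OF 1 2] w by linarith
  then have "?X * ?B \<le> (2 * k * ?O - k\<^sup>2 * ?B) * ?B" using pos by (rule mult_right_mono)
  also have "\<dots> = ?O\<^sup>2 - (?O - k * ?B)\<^sup>2" by (simp add: power2_eq_square algebra_simps)
  also have "\<dots> \<le> ?O\<^sup>2" by simp
  finally show ?thesis .
qed

text \<open>The Cauchy-Schwarz inequality for \<open>F/s\<close> and \<open>1\<close> with respect to the weight \<open>s r\<close>, which for a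
  convex body is twice the cone measure.\<close>

lemma cauchy_schwarz_weighted:
  fixes s r F :: "real \<Rightarrow> real"
  assumes c: "continuous_on UNIV s" "continuous_on UNIV r" "continuous_on UNIV F"
    and pos: "\<And>x. s x > 0" "\<And>x. r x > 0"
  shows "(integral {a..b} (\<lambda>x. F x * r x))\<^sup>2
    \<le> integral {a..b} (\<lambda>x. (F x)\<^sup>2 * r x / s x) * integral {a..b} (\<lambda>x. s x * r x)"
proof -
  let ?J = "integral {a..b} (\<lambda>x. (F x)\<^sup>2 * r x / s x)"
  let ?B = "integral {a..b} (\<lambda>x. s x * r x)"
  let ?O = "integral {a..b} (\<lambda>x. F x * r x)"
  have s0: "s x \<noteq> 0" for x using pos(1)[of x] by simp
  have quad: "0 \<le> ?J - (2 * k) * ?O + k\<^sup>2 * ?B" for k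
  proof (rule has_integral_nonneg)
    show "((\<lambda>x. (F x)\<^sup>2 * r x / s x - (2 * k) * (F x * r x) + k\<^sup>2 * (s x * r x))
        has_integral (?J - (2 * k) * ?O + k\<^sup>2 * ?B)) {a..b}"
      by (intro has_integral_add has_integral_diff has_integral_mult_right integrable_integral
          continuous_UNIV_integrable continuous_intros c ballI s0)
    show "0 \<le> (F x)\<^sup>2 * r x / s x - (2 * k) * (F x * r x) + k\<^sup>2 * (s x * r x)" for x
    proof -
      have "(F x)\<^sup>2 * r x / s x - (2 * k) * (F x * r x) + k\<^sup>2 * (s x * r x)
          = r x / s x * (F x - k * s x)\<^sup>2"
        using s0[of x] by (simp add: power2_eq_square field_simps)
      then show ?thesis using pos[of x] by simp
    qed
  qed
  have "0 \<le> ?B"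
    by (intro integral_nonneg continuous_UNIV_integrable continuous_intros c)
      (simp add: pos[THEN less_imp_le])
  then consider "?B > 0" | "?B = 0" by linarith
  then show ?thesis
  proof cases
    case 1
    have "0 \<le> (?J - (2 * (?O / ?B)) * ?O + (?O / ?B)\<^sup>2 * ?B) * ?B"
      using quad[of "?O / ?B"] 1 by (intro mult_nonneg_nonneg) auto
    also have "\<dots> = ?J * ?B - ?O\<^sup>2" using 1 by (simp add: power2_eq_square field_simps)
    finally show ?thesis by simp
  next
    case 2
    have "?O = 0"
    proof (rule ccontr)
      assume "?O \<noteq> 0"
      \<comment> \<open>This \<open>k\<close> gives the quadratic, linear since \<open>\<integral> s r = 0\<close>, the value \<open>- 1\<close>.\<close>
      then show False using quad[of "(?J + 1) / (2 * ?O)"] 2 by (simp add: field_simps)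
    qed
    then show ?thesis using 2 by simp
  qed
qed

text \<open>With \<open>g = F/s\<close> the integrand of \<open>P\<close> is \<open>s\<^sup>2 g'\<^sup>2\<close> and that of \<open>J\<close> is \<open>s r g\<^sup>2\<close>.  Since
  \<open>s'' = r - s\<close>, the integrand \<open>F\<^sup>2 - F'\<^sup>2\<close> differs from \<open>s r g\<^sup>2 - s\<^sup>2 g'\<^sup>2\<close> by the exact derivative
  \<open>(F\<^sup>2 s'/s)'\<close>, and \<open>F (F'' + F)\<close> differs from \<open>F\<^sup>2 - F'\<^sup>2\<close> by \<open>(F F')'\<close>.\<close>

lemma energy_identities:
  fixes s s' r F F' F'' :: "real \<Rightarrow> real"
  assumes s: "\<And>x. (s has_real_derivative s' x) (at x)"
    and s': "\<And>x. (s' has_real_derivative r x - s x) (at x)"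
    and F: "\<And>x. (F has_real_derivative F' x) (at x)"
    and F': "\<And>x. (F' has_real_derivative F'' x) (at x)"
    and c: "continuous_on UNIV r" "continuous_on UNIV F''"
    and per: "\<And>x. s (x + pi) = s x" "\<And>x. F (x + pi) = F x"
    and pos: "\<And>x. s x > 0"
  defines "J \<equiv> integral {0..2*pi} (\<lambda>x. (F x)\<^sup>2 * r x / s x)"
    and "P \<equiv> integral {0..2*pi} (\<lambda>x. (F' x - F x * s' x / s x)\<^sup>2)"
  shows "integral {0..2*pi} (\<lambda>x. (F x)\<^sup>2 - (F' x)\<^sup>2) = J - P"
    and "integral {0..2*pi} (\<lambda>x. F x * (F'' x + F x)) = J - P"
proof -
  have s0: "s x \<noteq> 0" for x using pos(1)[of x] by simp
  have cs: "continuous_on UNIV s" "continuous_on UNIV s'" "continuous_on UNIV F" "continuous_on UNIV F'"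
    by (fact DERIV_continuous_on[OF s] DERIV_continuous_on[OF s'] DERIV_continuous_on[OF F]
        DERIV_continuous_on[OF F'])+
  have per2: "s (2 * pi) = s 0" "F (2 * pi) = F 0" "s' (2 * pi) = s' 0" "F' (2 * pi) = F' 0"
    using per[of 0] per[of pi]
      DERIV_periodic[where f = s, OF s per(1), of 0] DERIV_periodic[where f = s, OF s per(1), of pi]
      DERIV_periodic[where f = F, OF F per(2), of 0] DERIV_periodic[where f = F, OF F per(2), of pi]
    by auto
  define h where "h x = (F x)\<^sup>2 * s' x / s x" for x
  define h' where "h' x = 2 * F x * F' x * s' x / s x + (F x)\<^sup>2 * (r x - s x) / s x
      - (F x)\<^sup>2 * (s' x)\<^sup>2 / (s x)\<^sup>2" for x
  have "(h has_real_derivative h' x) (at x)" for x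
    unfolding h_def h'_def using s0[of x]
    by (auto intro!: derivative_eq_intros s s' F simp: power2_eq_square field_simps)
  then have h: "(h' has_integral 0) {0..2*pi}"
    by (rule integral_deriv_periodic) (auto simp: h_def per2)
  have JP: "((\<lambda>x. (F x)\<^sup>2 * r x / s x - (F' x - F x * s' x / s x)\<^sup>2) has_integral (J - P)) {0..2*pi}"
    unfolding J_def P_def
    by (intro has_integral_diff integrable_integral
          continuous_UNIV_integrable continuous_intros cs c ballI s0)
  have "((\<lambda>x. (F x)\<^sup>2 * r x / s x - (F' x - F x * s' x / s x)\<^sup>2 - h' x)
      has_integral (J - P - 0)) {0..2*pi}"
    by (rule has_integral_diff[OF JP h])
  also have "(\<lambda>x. (F x)\<^sup>2 * r x / s x - (F' x - F x * s' x / s x)\<^sup>2 - h' x)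
      = (\<lambda>x. (F x)\<^sup>2 - (F' x)\<^sup>2)"
  proof
    fix x
    have "(F x)\<^sup>2 * (r x - s x) / s x = (F x)\<^sup>2 * r x / s x - (F x)\<^sup>2"
      using s0[of x] by (simp add: field_simps)
    then show "(F x)\<^sup>2 * r x / s x - (F' x - F x * s' x / s x)\<^sup>2 - h' x = (F x)\<^sup>2 - (F' x)\<^sup>2"
      unfolding h'_def by (simp add: power2_diff power_divide power_mult_distrib)
  qed
  finally have Q: "((\<lambda>x. (F x)\<^sup>2 - (F' x)\<^sup>2) has_integral (J - P)) {0..2*pi}" by simp
  then show "integral {0..2*pi} (\<lambda>x. (F x)\<^sup>2 - (F' x)\<^sup>2) = J - P" by (rule integral_unique)
  have "((\<lambda>x. F x * F' x) has_real_derivative (F' x)\<^sup>2 + F x * F'' x) (at x)" for x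
    by (auto intro!: derivative_eq_intros F F' simp: power2_eq_square)
  then have "((\<lambda>x. (F' x)\<^sup>2 + F x * F'' x) has_integral 0) {0..2*pi}"
    by (rule integral_deriv_periodic) (auto simp: per2)
  from has_integral_add[OF Q this]
  have "((\<lambda>x. F x * (F'' x + F x)) has_integral (J - P)) {0..2*pi}"
    by (simp add: power2_eq_square algebra_simps)
  then show "integral {0..2*pi} (\<lambda>x. F x * (F'' x + F x)) = J - P" by (rule integral_unique)
qed

section \<open>Convex bodies in the Gauss parametrization\<close>

lemma inner_normal_vec: "x \<bullet> normal_vec \<theta> = x $ 1 * cos \<theta> + x $ 2 * sin \<theta>"
  by (simp add: normal_vec_def inner_vec_def sum_2)

lemma norm_normal_vec: "norm (normal_vec \<theta>) = 1"
  by (simp add: normal_vec_def norm_vec_def L2_set_def sum_2)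

lemma bracket_components: "bracket u v = u $ 1 * v $ 2 - u $ 2 * v $ 1"
  by (simp add: bracket_def det_2)

lemma interior_not_supporting:
  fixes K :: "(real^2) set"
  assumes "x \<in> interior K"
  obtains y where "y \<in> K" "x \<bullet> normal_vec \<theta> < y \<bullet> normal_vec \<theta>"
proof -
  obtain e where e: "e > 0" "cball x e \<subseteq> K" using assms mem_interior_cball by blast
  have "x + e *\<^sub>R normal_vec \<theta> \<in> K"
    using e by (intro subsetD[OF e(2)]) (simp add: dist_norm norm_normal_vec)
  moreover have "normal_vec \<theta> \<bullet> normal_vec \<theta> = 1"
    by (simp add: dot_square_norm norm_normal_vec)
  ultimately show ?thesis using e that by (fastforce simp: inner_add_left)
qed

text \<open>Compactness gives a maximizer of the linear functional, and it lies on the frontier because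
  linear functionals have no interior maximum.  For the same reason it is unique: the midpoint of
  two maximizers would be an interior one by strict convexity.\<close>

lemma gauss_param_supporting:
  assumes "strictly_convex_body K"
  shows "gauss_param K \<theta> \<in> K" and "y \<in> K \<Longrightarrow> y \<bullet> normal_vec \<theta> \<le> gauss_param K \<theta> \<bullet> normal_vec \<theta>"
    and "support K \<theta> = gauss_param K \<theta> \<bullet> normal_vec \<theta>"
proof -
  have K: "compact K" "interior K \<noteq> {}"
    and sc: "\<And>x y. x \<in> K \<Longrightarrow> y \<in> K \<Longrightarrow> x \<noteq> y \<Longrightarrow> open_segment x y \<subseteq> interior K"
    using assms by (auto simp: strictly_convex_body_def)
  let ?n = "normal_vec \<theta>"
  let ?P = "\<lambda>x. x \<in> frontier K \<and> (\<forall>y\<in>K. (y - x) \<bullet> ?n \<le> 0)"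
  have P: "?P x \<longleftrightarrow> x \<in> K \<and> (\<forall>y\<in>K. y \<bullet> ?n \<le> x \<bullet> ?n)" for x
  proof
    assume "?P x"
    then show "x \<in> K \<and> (\<forall>y\<in>K. y \<bullet> ?n \<le> x \<bullet> ?n)"
      using compact_imp_closed[OF K(1)] frontier_subset_closed by (auto simp: inner_diff_left)
  next
    assume a: "x \<in> K \<and> (\<forall>y\<in>K. y \<bullet> ?n \<le> x \<bullet> ?n)"
    then have "x \<notin> interior K" using interior_not_supporting by (metis not_le)
    then show "?P x" using a closure_subset by (auto simp: frontier_def inner_diff_left)
  qed
  have "\<exists>x\<in>K. \<forall>y\<in>K. y \<bullet> ?n \<le> x \<bullet> ?n"
    using K interior_subset by (intro continuous_attains_sup continuous_intros) auto
  then obtain x where x: "?P x" using P by blast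
  have "z = x" if z: "?P z" for z
  proof (rule ccontr)
    assume "z \<noteq> x"
    then have mid: "midpoint z x \<in> interior K"
      using sc[of z x] x z P midpoint_in_open_segment by blast
    have "z \<bullet> ?n = x \<bullet> ?n" using x z P by (meson order_antisym)
    then have "midpoint z x \<bullet> ?n = x \<bullet> ?n" by (simp add: midpoint_def inner_add_left)
    then show False using interior_not_supporting[OF mid, of \<theta>] x P by (metis not_le)
  qed
  with x have "?P (gauss_param K \<theta>)" unfolding gauss_param_def by (rule theI)
  then show g: "gauss_param K \<theta> \<in> K" and m: "y \<in> K \<Longrightarrow> y \<bullet> ?n \<le> gauss_param K \<theta> \<bullet> ?n" for y
    using P by blast+
  show "support K \<theta> = gauss_param K \<theta> \<bullet> normal_vec \<theta>"
    unfolding support_def using g m by (intro cSup_eq_maximum) auto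
qed

text \<open>An interior point \<open>x\<close> satisfies \<open>x \<bullet> n < s\<close>, and its antipode gives \<open>- x \<bullet> n \<le> s\<close>.\<close>

lemma support_pos:
  assumes "K \<in> K_sym"
  shows "support K \<theta> > 0"
proof -
  have sc: "strictly_convex_body K" and sym: "uminus ` K = K"
    using assms by (auto simp: K_sym_def)
  obtain x where x: "x \<in> interior K" using sc by (auto simp: strictly_convex_body_def)
  then have "x \<in> K" "- x \<in> K" using sym interior_subset by blast+
  obtain y where "y \<in> K" and "x \<bullet> normal_vec \<theta> < y \<bullet> normal_vec \<theta>"
    using interior_not_supporting[OF x] .
  then have "x \<bullet> normal_vec \<theta> < support K \<theta>"
    using gauss_param_supporting(2)[OF sc \<open>y \<in> K\<close>, of \<theta>] gauss_param_supporting(3)[OF sc, of \<theta>]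
    by linarith
  moreover have "- (x \<bullet> normal_vec \<theta>) \<le> support K \<theta>"
    using gauss_param_supporting(2)[OF sc \<open>- x \<in> K\<close>, of \<theta>] gauss_param_supporting(3)[OF sc, of \<theta>]
    by simp
  ultimately show ?thesis by linarith
qed

lemma support_symmetric:
  assumes "K \<in> K_sym"
  shows "support K (\<theta> + pi) = support K \<theta>"
proof -
  have "uminus ` K = K" using assms by (simp add: K_sym_def)
  then have "support K (\<theta> + pi) = Sup ((\<lambda>x. x \<bullet> normal_vec (\<theta> + pi)) ` uminus ` K)"
    by (simp add: support_def)
  also have "\<dots> = support K \<theta>"
    unfolding support_def image_image by (simp add: inner_normal_vec)
  finally show ?thesis .
qed

lemma has_vector_derivative_nth:
  assumes "(f has_vector_derivative D) (at u)"
  shows "((\<lambda>u. f u $ i) has_real_derivative D $ i) (at u)"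
  using bounded_linear.has_vector_derivative[OF bounded_linear_vec_nth assms]
  by (simp add: has_real_derivative_iff_has_vector_derivative)

text \<open>Near \<open>a\<close> the factor \<open>sin (a - x)\<close> has the signs of the derivative of a function with a maximum
  at \<open>a\<close>, so a negative \<open>r a\<close> would make \<open>f\<close> increase to the right of \<open>a\<close>.  For a convex curve this
  yields the sign of the radius of curvature, with \<open>f\<close> the height in a fixed direction as a
  function of the normal angle.\<close>

lemma weight_nonneg_at_max:
  fixes f r :: "real \<Rightarrow> real"
  assumes d: "\<And>x. (f has_real_derivative r x * sin (a - x)) (at x)"
    and max: "\<And>x. f x \<le> f a" and c: "isCont r a"
  shows "0 \<le> r a"
proof (rule ccontr)
  assume "\<not> 0 \<le> r a"
  then have "eventually (\<lambda>x. r x < 0) (at_right a)"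
    using c unfolding isCont_def
    by (intro filterlim_mono[THEN order_tendstoD(2)]) (auto intro: at_le)
  then obtain b where b: "b > a" "\<And>y. a < y \<Longrightarrow> y < b \<Longrightarrow> r y < 0"
    unfolding eventually_at_right_field by blast
  define x where "x = min b (a + pi)"
  have "a < x" by (simp add: x_def b)
  then obtain z where z: "a < z" "z < x" "f x - f a = (x - a) * (r z * sin (a - z))"
    using MVT2[of a x f "\<lambda>x. r x * sin (a - x)"] d by blast
  have "sin (z - a) > 0" using z by (intro sin_gt_zero) (auto simp: x_def)
  then have "sin (a - z) < 0" by (metis minus_diff_eq neg_0_less_iff_less sin_minus)
  moreover have "r z < 0" using z b(2) by (auto simp: x_def)
  ultimately have "f x - f a > 0" using z by (simp add: mult_neg_neg)
  then show False using max[of x] by linarith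
qed

text \<open>The classical formulas for the Gauss parametrization.  Differentiating at the maximum
  \<open>\<gamma>(v) \<bullet> n(u) \<le> \<gamma>(u) \<bullet> n(u)\<close> shows that \<open>\<gamma>'\<close> is orthogonal to the normal \<open>n\<close>, so
  \<open>\<gamma>' = r n'\<close> for some \<open>r\<close>.  The immersion hypothesis excludes \<open>r = 0\<close> and the maximum excludes
  \<open>r < 0\<close>; the brackets then identify \<open>r\<close> with the radius of curvature, and \<open>s = \<gamma> \<bullet> n\<close> has the
  derivatives \<open>s' = \<gamma> \<bullet> n'\<close> and \<open>s'' = r - s\<close>.\<close>

lemma K_sym_geometry:
  assumes K: "K \<in> K_sym"
  obtains s' r' where
    "\<And>\<theta>. (support K has_real_derivative s' \<theta>) (at \<theta>)"
    "\<And>\<theta>. (s' has_real_derivative curv_radius K \<theta> - support K \<theta>) (at \<theta>)"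
    "\<And>\<theta>. (curv_radius K has_real_derivative r' \<theta>) (at \<theta>)"
    "\<And>\<theta>. curv_radius K \<theta> > 0"
    "\<And>\<theta>. bracket (gauss_param K \<theta>) (vderiv (gauss_param K) \<theta>) = support K \<theta> * curv_radius K \<theta>"
    "\<And>\<theta>. bracket (vderiv (gauss_param K) \<theta>) (vderiv (vderiv (gauss_param K)) \<theta>) = (curv_radius K \<theta>)\<^sup>2"
proof -
  have sc: "strictly_convex_body K" using K by (simp add: K_sym_def)
  define \<gamma> where "\<gamma> = gauss_param K"
  note g = gauss_param_supporting[OF sc, folded \<gamma>_def]
  have sm: "smooth_curve \<gamma>" and imm: "\<And>\<theta>. vderiv \<gamma> \<theta> \<noteq> 0"
    using K by (auto simp: K_sym_def \<gamma>_def)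
  have diff: "(vderiv ^^ k) \<gamma> differentiable (at u)" for k u
    using sm unfolding smooth_curve_def by blast
  have d1: "(\<gamma> has_vector_derivative vderiv \<gamma> u) (at u)" for u
    using diff[of 0] vector_derivative_works by auto
  have d2: "(vderiv \<gamma> has_vector_derivative vderiv (vderiv \<gamma>) u) (at u)" for u
    using diff[of 1] vector_derivative_works by auto
  define x y x' y' x'' y'' where xy: "x = (\<lambda>u. \<gamma> u $ 1)" "y = (\<lambda>u. \<gamma> u $ 2)"
    "x' = (\<lambda>u. vderiv \<gamma> u $ 1)" "y' = (\<lambda>u. vderiv \<gamma> u $ 2)"
    "x'' = (\<lambda>u. vderiv (vderiv \<gamma>) u $ 1)" "y'' = (\<lambda>u. vderiv (vderiv \<gamma>) u $ 2)"
  have x: "(x has_real_derivative x' u) (at u)" and y: "(y has_real_derivative y' u) (at u)"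
    and x': "(x' has_real_derivative x'' u) (at u)" and y': "(y' has_real_derivative y'' u) (at u)" for u
    unfolding xy by (intro has_vector_derivative_nth d1 d2)+
  have s: "support K = (\<lambda>u. x u * cos u + y u * sin u)"
    by (auto simp: g(3) inner_normal_vec xy)
  have max: "x v * cos u + y v * sin u \<le> x u * cos u + y u * sin u" for u v
    using g(2)[OF g(1), of v u] by (simp add: inner_normal_vec xy)
  have orth: "x' u * cos u + y' u * sin u = 0" for u
  proof -
    have "((\<lambda>v. x v * cos u + y v * sin u) has_real_derivative x' u * cos u + y' u * sin u) (at u)"
      by (auto intro!: derivative_eq_intros x y)
    then show ?thesis using DERIV_local_max[OF _ zero_less_one] max by blast
  qed
  define s' where "s' u = - x u * sin u + y u * cos u" for u
  define r where "r u = - x' u * sin u + y' u * cos u" for u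
  define r' where "r' u = - x'' u * sin u - x' u * cos u + y'' u * cos u - y' u * sin u" for u
  have r': "(r has_real_derivative r' u) (at u)" for u
    unfolding r_def r'_def by (auto intro!: derivative_eq_intros x' y')
  have x'_r: "x' = (\<lambda>u. - r u * sin u)" and y'_r: "y' = (\<lambda>u. r u * cos u)"
  proof -
    have "x' u = (x' u * cos u + y' u * sin u) * cos u - r u * sin u" for u
      using sin_cos_squared_add[of u] unfolding r_def by algebra
    then show "x' = (\<lambda>u. - r u * sin u)" by (auto simp: orth)
    have "y' u = (x' u * cos u + y' u * sin u) * sin u + r u * cos u" for u
      using sin_cos_squared_add[of u] unfolding r_def by algebra
    then show "y' = (\<lambda>u. r u * cos u)" by (auto simp: orth)
  qed
  have r0: "r u \<noteq> 0" for u
    using imm[of u] x'_r y'_r by (auto simp: vec_eq_iff forall_2 xy dest!: fun_cong[of _ _ u])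
  have r_nonneg: "0 \<le> r u" for u
  proof (rule weight_nonneg_at_max[where r = r and a = u and f = "\<lambda>v. x v * cos u + y v * sin u"])
    fix v
    have "((\<lambda>v. x v * cos u + y v * sin u) has_real_derivative x' v * cos u + y' v * sin u) (at v)"
      by (auto intro!: derivative_eq_intros x y)
    then show "((\<lambda>v. x v * cos u + y v * sin u) has_real_derivative r v * sin (u - v)) (at v)"
      by (simp add: x'_r y'_r sin_diff algebra_simps)
  qed (use max DERIV_isCont[OF r'] in auto)
  with r0 have r_pos: "r u > 0" for u by (metis less_eq_real_def)
  have x''_r: "x'' u = - r' u * sin u - r u * cos u" for u
    by (rule DERIV_unique[OF x'], unfold x'_r) (auto intro!: derivative_eq_intros r')
  have y''_r: "y'' u = r' u * cos u - r u * sin u" for u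
    by (rule DERIV_unique[OF y'], unfold y'_r) (auto intro!: derivative_eq_intros r')
  have "x' u * y'' u - y' u * x'' u = (r u)\<^sup>2" for u
    unfolding x'_r y'_r x''_r y''_r using sin_cos_squared_add[of u] by algebra
  then have br: "bracket (vderiv \<gamma> u) (vderiv (vderiv \<gamma>) u) = (r u)\<^sup>2" for u
    by (simp add: bracket_components xy)
  have nr: "norm (vderiv \<gamma> u) = r u" for u
  proof -
    have "(norm (vderiv \<gamma> u))\<^sup>2 = (x' u)\<^sup>2 + (y' u)\<^sup>2"
      by (simp add: norm_vec_def L2_set_def sum_2 xy)
    also have "\<dots> = (r u)\<^sup>2"
      unfolding x'_r y'_r using sin_cos_squared_add[of u] by algebra
    finally show ?thesis using r_pos[of u] by (simp add: power2_eq_iff_nonneg)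
  qed
  have "kappa K u = 1 / r u" for u
    unfolding kappa_def curvature_def \<gamma>_def[symmetric] br nr using r_pos[of u]
    by (simp add: power2_eq_square power3_eq_cube)
  then have cr: "curv_radius K = r" by (auto simp: curv_radius_def)
  have "(support K has_real_derivative s' u) (at u)" for u
  proof -
    have "(support K has_real_derivative x' u * cos u + y' u * sin u + s' u) (at u)"
      unfolding s s'_def by (auto intro!: derivative_eq_intros x y)
    then show ?thesis by (simp add: orth)
  qed
  moreover have "(s' has_real_derivative curv_radius K u - support K u) (at u)" for u
    unfolding s'_def cr s r_def by (auto intro!: derivative_eq_intros x y)
  moreover have "bracket (\<gamma> u) (vderiv \<gamma> u) = support K u * curv_radius K u" for u
  proof -
    have "bracket (\<gamma> u) (vderiv \<gamma> u) = x u * y' u - y u * x' u"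
      by (simp add: bracket_components xy)
    then show ?thesis by (simp add: x'_r y'_r cr s algebra_simps)
  qed
  ultimately show ?thesis
    using that[of s' r'] r' r_pos br unfolding cr \<gamma>_def by blast
qed

lemma Omega_integrand:
  fixes K :: "(real^2) set" and p :: real
  assumes K: "K \<in> K_sym" 
  defines "m \<equiv> p / (p + 2)"
  defines "F \<equiv> \<lambda>x. support K x powr (1 - 3 * m) * curv_radius K x powr (- m)"
  shows "support K x / kappa K x * (kappa K x / support K x ^ 3) powr (p / (p + 2)) = F x * curv_radius K x"
proof -
  have s: "support K x > 0" using support_pos[OF K] .
  have r: "curv_radius K x > 0" using K_sym_geometry[OF K] by blast
  have k: "kappa K x = 1 / curv_radius K x" by (simp add: curv_radius_def)
  let ?s = "support K x" and ?r = "curv_radius K x"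
  have "(kappa K x / ?s ^ 3) powr m = (?r powr (-1) * ?s powr (-3)) powr m"
    using s r by (simp add: k powr_minus divide_simps)
  also have "\<dots> = ?r powr (-m) * ?s powr (-3 * m)"
    unfolding powr_mult powr_powr by simp
  finally have "(kappa K x / ?s ^ 3) powr m = ?r powr (-m) * ?s powr (-3 * m)" .
  moreover have "?s powr (1 - 3 * m) = ?s * ?s powr (-3 * m)"
    using s powr_add[of ?s 1 "-3 * m"] by simp
  ultimately show ?thesis by (simp add: F_def m_def k)
qed

text \<open>In the normal angle, \<open>d\<ss> = r\<^sup>2\<^sup>/\<^sup>3 d\<theta>\<close> and \<open>\<sigma> = s r\<^sup>1\<^sup>/\<^sup>3\<close>, so that \<open>F = s \<sigma>\<^sup>-\<^sup>3\<^sup>m\<close>.  Hence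
  \<open>F' - F s'/s = s (F/s)'\<close> equals \<open>- 3 m F w\<close> where \<open>w\<close> is the logarithmic derivative of \<open>\<sigma>\<close>, and its
  square is, up to the factor \<open>9 m\<^sup>2\<close>, the affine integrand.\<close>

lemma affine_integral_eq:
  fixes K :: "(real^2) set" and m :: real
  assumes K: "K \<in> K_sym"
    and s': "\<And>x. (support K has_real_derivative s' x) (at x)"
    and F': "\<And>x. (F has_real_derivative F' x) (at x)"
    and F_def: "F = (\<lambda>x. support K x powr (1 - 3 * m) * curv_radius K x powr (- m))"
  defines "\<gamma> \<equiv> gauss_param K"
  defines "\<sigma> \<equiv> affine_support \<gamma>"
  shows "9 * m\<^sup>2 * affine_integral \<gamma> (\<lambda>u. \<sigma> u powr (- 6 * m) * (affine_deriv \<gamma> \<sigma> u)\<^sup>2)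
    = integral {0..2*pi} (\<lambda>x. (F' x - F x * s' x / support K x)\<^sup>2)"
proof -
  let ?s = "support K" and ?r = "curv_radius K"
  obtain r' where r': "\<And>x. (?r has_real_derivative r' x) (at x)" and r: "\<And>x. ?r x > 0"
    and b1: "\<And>x. bracket (\<gamma> x) (vderiv \<gamma> x) = ?s x * ?r x"
    and b2: "\<And>x. bracket (vderiv \<gamma> x) (vderiv (vderiv \<gamma>) x) = (?r x)\<^sup>2"
    using K_sym_geometry[OF K] unfolding \<gamma>_def by metis
  have s: "?s x > 0" for x using support_pos[OF K] .
  have speed: "affine_speed \<gamma> x = ?r x powr (2/3)" for x
    using r[of x] powr_powr[of "?r x" 2 "1/3"] by (simp add: affine_speed_def b2)
  have "\<sigma> x = ?s x * ?r x powr (1/3)" for x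
  proof -
    have "\<sigma> x = bracket (\<gamma> x) (vderiv \<gamma> x) / affine_speed \<gamma> x"
      by (simp add: \<sigma>_def affine_support_def affine_deriv_def bracket_components field_simps
          flip: diff_divide_distrib)
    also have "\<dots> = ?s x * (?r x powr 1 / ?r x powr (2/3))"
      using less_imp_le[OF r[of x]] by (simp add: b1 speed)
    also have "\<dots> = ?s x * ?r x powr (1/3)" by (subst powr_diff[symmetric]) simp
    finally show ?thesis .
  qed
  then have \<sigma>: "\<sigma> = (\<lambda>x. ?s x * ?r x powr (1/3))" by blast
  define w where "w x = s' x / ?s x + r' x / (3 * ?r x)" for x
  have pr: "?r x powr (a - 1) = ?r x powr a / ?r x" "?s x powr (a - 1) = ?s x powr a / ?s x" for a x
    using r[of x] s[of x] by (simp_all add: powr_diff)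
  have "(\<sigma> has_real_derivative \<sigma> x * w x) (at x)" for x
  proof -
    have "(\<sigma> has_real_derivative s' x * ?r x powr (1/3) + ?s x * (1/3 * ?r x powr (1/3 - 1) * r' x)) (at x)"
      unfolding \<sigma> using r[of x] by (auto intro!: derivative_eq_intros s' r')
    then show ?thesis
    proof (rule DERIV_cong)
      show "s' x * ?r x powr (1/3) + ?s x * (1/3 * ?r x powr (1/3 - 1) * r' x) = \<sigma> x * w x"
        unfolding pr using r[of x] s[of x] by (simp add: \<sigma> w_def field_simps)
    qed
  qed
  then have \<sigma>': "vector_derivative \<sigma> (at x) = \<sigma> x * w x" for x
    by (simp add: has_real_derivative_iff_has_vector_derivative vector_derivative_at)
  have F'_eq: "F' x = F x * ((1 - 3 * m) * s' x / ?s x - m * r' x / ?r x)" for x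
  proof (rule DERIV_unique[OF F'])
    have "(F has_real_derivative (1 - 3 * m) * ?s x powr (1 - 3 * m - 1) * s' x * ?r x powr (- m)
        + ?s x powr (1 - 3 * m) * (- m * ?r x powr (- m - 1) * r' x)) (at x)"
      unfolding F_def using r[of x] s[of x] by (auto intro!: derivative_eq_intros s' r')
    then show "(F has_real_derivative F x * ((1 - 3 * m) * s' x / ?s x - m * r' x / ?r x)) (at x)"
    proof (rule DERIV_cong)
      show "(1 - 3 * m) * ?s x powr (1 - 3 * m - 1) * s' x * ?r x powr (- m)
          + ?s x powr (1 - 3 * m) * (- m * ?r x powr (- m - 1) * r' x)
          = F x * ((1 - 3 * m) * s' x / ?s x - m * r' x / ?r x)"
        unfolding pr F_def by (simp only: times_divide_eq_right times_divide_eq_left)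
          (simp add: algebra_simps)
    qed
  qed
  have F2: "\<sigma> x powr (- 6 * m) * (\<sigma> x)\<^sup>2 = (F x)\<^sup>2 * ?r x powr (2/3)" for x
  proof -
    have sq: "(z powr a)\<^sup>2 = z powr (2 * a)" for z a :: real
      by (simp add: power2_eq_square flip: powr_add)
    have "\<sigma> x powr (- 6 * m) = ?s x powr (-6 * m) * ?r x powr (-2 * m)"
      by (simp add: \<sigma> powr_mult powr_powr)
    moreover have "(\<sigma> x)\<^sup>2 = (?s x)\<^sup>2 * ?r x powr (2/3)"
      by (simp add: \<sigma> power_mult_distrib sq)
    moreover have "(F x)\<^sup>2 = ?s x powr (2 + - 6 * m) * ?r x powr (-2 * m)"
      by (simp add: F_def power_mult_distrib sq algebra_simps)
    moreover have "?s x powr (2 + - 6 * m) = (?s x)\<^sup>2 * ?s x powr (- 6 * m)"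
      unfolding powr_add using s[of x] by simp
    ultimately show ?thesis by simp
  qed
  have "9 * m\<^sup>2 * (\<sigma> x powr (- 6 * m) * (affine_deriv \<gamma> \<sigma> x)\<^sup>2 * affine_speed \<gamma> x)
      = (F' x - F x * s' x / ?s x)\<^sup>2" for x
  proof -
    let ?v = "?r x powr (2/3)"
    have v: "?v > 0" using r[of x] by simp
    have "\<sigma> x powr (- 6 * m) * (affine_deriv \<gamma> \<sigma> x)\<^sup>2 * affine_speed \<gamma> x
        = \<sigma> x powr (- 6 * m) * (\<sigma> x)\<^sup>2 * (w x)\<^sup>2 / ?v"
      using v by (simp add: affine_deriv_def speed \<sigma>' power2_eq_square field_simps)
    also have "\<dots> = (F x * w x)\<^sup>2" unfolding F2 using v by (simp add: power_mult_distrib)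
    finally have "9 * m\<^sup>2 * (\<sigma> x powr (- 6 * m) * (affine_deriv \<gamma> \<sigma> x)\<^sup>2 * affine_speed \<gamma> x)
      = (- 3 * m * F x * w x)\<^sup>2" by (simp add: power_mult_distrib)
    moreover have "F' x - F x * s' x / ?s x = - 3 * m * F x * w x"
      unfolding F'_eq w_def using r[of x] s[of x] by (simp add: field_simps)
    ultimately show ?thesis by simp
  qed
  then show ?thesis unfolding affine_integral_def
    by (simp flip: integral_mult_right)
qed

section \<open>Evolution equations\<close>

lemma has_real_derivative_unique_Ico:
  fixes f :: "real \<Rightarrow> real"
  assumes "(f has_real_derivative D) (at t within {a..<b})" "(f has_real_derivative E) (at t within {a..<b})"
    and "t \<in> {a..<b}"
  shows "D = E"
proof (rule vector_derivative_unique_within)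
  have "t islimpt {a..<b}" using assms(3) by simp
  then show "at t within {a..<b} \<noteq> bot" using trivial_limit_within by blast
qed (use assms in \<open>auto simp: has_real_derivative_iff_has_vector_derivative\<close>)

text \<open>The time derivative of \<open>f\<^sub>\<theta>\<close> is obtained, together with its existence, from an integral formula:
  differentiate \<open>f(\<theta>, \<tau>) = f(\<theta>, 0) + \<integral>\<^sub>0\<^sup>\<tau> f\<^sub>t\<close> in \<open>\<theta>\<close> under the integral sign, then the result in
  \<open>\<tau>\<close>.  This includes the one-sided derivative at the initial time.\<close>

lemma mixed_partial_derivative:
  fixes f f\<^sub>t f\<^sub>\<theta> f\<^sub>t\<^sub>\<theta> :: "real \<Rightarrow> real \<Rightarrow> real"
  assumes f\<^sub>t: "\<And>\<theta> t. t \<in> {0..<T} \<Longrightarrow> (f \<theta> has_real_derivative f\<^sub>t \<theta> t) (at t within {0..<T})"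
    and f\<^sub>\<theta>: "\<And>\<theta> t. t \<in> {0..<T} \<Longrightarrow> ((\<lambda>\<theta>. f \<theta> t) has_real_derivative f\<^sub>\<theta> \<theta> t) (at \<theta>)"
    and f\<^sub>t\<^sub>\<theta>: "\<And>\<theta> t. t \<in> {0..<T} \<Longrightarrow> ((\<lambda>\<theta>. f\<^sub>t \<theta> t) has_real_derivative f\<^sub>t\<^sub>\<theta> \<theta> t) (at \<theta>)"
    and c: "continuous_on (UNIV \<times> {0..<T}) (\<lambda>(\<theta>, t). f\<^sub>t \<theta> t)"
      "continuous_on (UNIV \<times> {0..<T}) (\<lambda>(\<theta>, t). f\<^sub>t\<^sub>\<theta> \<theta> t)"
    and t: "t \<in> {0..<T}"
  shows "(f\<^sub>\<theta> \<theta> has_real_derivative f\<^sub>t\<^sub>\<theta> \<theta> t) (at t within {0..<T})"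
proof -
  have slice: "continuous_on S (g \<theta>)"
    if "continuous_on (UNIV \<times> {0..<T}) (\<lambda>(\<theta>, t). g \<theta> t)" "S \<subseteq> {0..<T}"
    for S and g :: "real \<Rightarrow> real \<Rightarrow> real" and \<theta>
    using that by (auto intro!: continuous_on_compose2[where g = "\<lambda>(\<theta>, t). g \<theta> t" and f = "Pair \<theta>", simplified]
        continuous_intros)
  have rep: "f \<eta> \<tau> = f \<eta> 0 + integral {0..\<tau>} (f\<^sub>t \<eta>)" if \<tau>: "\<tau> \<in> {0..<T}" for \<eta> \<tau>
  proof -
    have "(f\<^sub>t \<eta> has_integral f \<eta> \<tau> - f \<eta> 0) {0..\<tau>}"
      using \<tau> by (intro fundamental_theorem_of_calculus)
        (auto simp: has_real_derivative_iff_has_vector_derivative[symmetric]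
          intro: DERIV_subset[OF f\<^sub>t])
    then show ?thesis by (simp add: integral_unique)
  qed
  have f\<^sub>\<theta>_rep: "f\<^sub>\<theta> \<theta> \<tau> = f\<^sub>\<theta> \<theta> 0 + integral {0..\<tau>} (f\<^sub>t\<^sub>\<theta> \<theta>)" if \<tau>: "\<tau> \<in> {0..<T}" for \<tau>
  proof (rule DERIV_unique[OF f\<^sub>\<theta>[OF \<tau>]])
    have "((\<lambda>\<eta>. integral (cbox 0 \<tau>) (f\<^sub>t \<eta>)) has_real_derivative integral (cbox 0 \<tau>) (f\<^sub>t\<^sub>\<theta> \<theta>))
        (at \<theta> within UNIV)"
    proof (rule leibniz_rule_field_derivative)
      show "continuous_on (UNIV \<times> cbox 0 \<tau>) (\<lambda>(\<eta>, t). f\<^sub>t\<^sub>\<theta> \<eta> t)"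
        by (rule continuous_on_subset[OF c(2)]) (use \<tau> in auto)
      show "f\<^sub>t \<eta> integrable_on cbox 0 \<tau>" for \<eta>
        by (rule integrable_continuous) (use \<tau> in \<open>auto intro!: slice[OF c(1)]\<close>)
    qed (use f\<^sub>t\<^sub>\<theta> \<tau> in auto)
    moreover have "((\<lambda>\<eta>. f \<eta> 0) has_real_derivative f\<^sub>\<theta> \<theta> 0) (at \<theta>)"
      using f\<^sub>\<theta> \<tau> by auto
    ultimately show "((\<lambda>\<eta>. f \<eta> \<tau>) has_real_derivative f\<^sub>\<theta> \<theta> 0 + integral {0..\<tau>} (f\<^sub>t\<^sub>\<theta> \<theta>)) (at \<theta>)"
      unfolding rep[OF \<tau>] by (auto intro: DERIV_add)
  qed
  \<comment> \<open>The fundamental theorem needs a compact time interval; near \<open>t\<close> it agrees with \<open>[0, T)\<close>.\<close>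
  obtain b where b: "t < b" "b < T" using t dense by auto
  have "((\<lambda>\<tau>. integral {0..\<tau>} (f\<^sub>t\<^sub>\<theta> \<theta>)) has_real_derivative f\<^sub>t\<^sub>\<theta> \<theta> t) (at t within {0..b})"
    using b t by (intro integral_has_real_derivative slice[OF c(2)]) auto
  moreover have "at t within {0..b} = at t within {0..<T}"
    by (rule at_within_nhd[where S = "{..<b}"]) (use b in auto)
  ultimately have "((\<lambda>\<tau>. f\<^sub>\<theta> \<theta> 0 + integral {0..\<tau>} (f\<^sub>t\<^sub>\<theta> \<theta>)) has_real_derivative f\<^sub>t\<^sub>\<theta> \<theta> t) (at t within {0..<T})"
    by (auto intro!: derivative_eq_intros)
  then show ?thesis
    by (rule has_field_derivative_transform_within[OF _ zero_less_one t]) (rule f\<^sub>\<theta>_rep[symmetric])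
qed

lemma Ck_on_continuous: "Ck_on k I f \<Longrightarrow> continuous_on (UNIV \<times> I) (\<lambda>(\<theta>, t). f \<theta> t)"
  by (cases k) auto

text \<open>Since \<open>F = - s\<^sub>t\<close>, the speed inherits its \<open>\<theta>\<close>-derivatives from the joint smoothness of \<open>s\<close>; and
  \<open>r = s\<^sub>\<theta>\<^sub>\<theta> + s\<close> turns the flow into the evolution equation of \<open>r\<close> once the derivatives are
  exchanged, which is done one \<open>\<theta>\<close> at a time.\<close>

lemma contracting_flow_evolution:
  fixes p T :: real and K :: "real \<Rightarrow> (real^2) set"
  assumes flow: "contracting_flow p T K"
    and m_def: "m = p / (p + 2)"
    and s_def: "s = (\<lambda>\<theta> t. support (K t) \<theta>)"
    and r_def: "r = (\<lambda>\<theta> t. curv_radius (K t) \<theta>)"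
    and F_def: "F = (\<lambda>\<theta> t. s \<theta> t powr (1 - 3 * m) * r \<theta> t powr (- m))"
  obtains F\<^sub>\<theta> F\<^sub>\<theta>\<^sub>\<theta> where
    "\<And>\<theta> t. t \<in> {0..<T} \<Longrightarrow> ((\<lambda>\<theta>. F \<theta> t) has_real_derivative F\<^sub>\<theta> \<theta> t) (at \<theta>)"
    "\<And>\<theta> t. t \<in> {0..<T} \<Longrightarrow> ((\<lambda>\<theta>. F\<^sub>\<theta> \<theta> t) has_real_derivative F\<^sub>\<theta>\<^sub>\<theta> \<theta> t) (at \<theta>)"
    "\<And>\<theta> t. t \<in> {0..<T} \<Longrightarrow> (s \<theta> has_real_derivative - F \<theta> t) (at t within {0..<T})"
    "\<And>\<theta> t. t \<in> {0..<T} \<Longrightarrow> (r \<theta> has_real_derivative - (F\<^sub>\<theta>\<^sub>\<theta> \<theta> t + F \<theta> t)) (at t within {0..<T})"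
    "continuous_on (UNIV \<times> {0..<T}) (\<lambda>(\<theta>, t). s \<theta> t)"
    "continuous_on (UNIV \<times> {0..<T}) (\<lambda>(\<theta>, t). r \<theta> t)"
    "continuous_on (UNIV \<times> {0..<T}) (\<lambda>(\<theta>, t). F\<^sub>\<theta>\<^sub>\<theta> \<theta> t)"
proof -
  let ?I = "{0..<T}"
  have K: "K t \<in> K_sym" if "t \<in> ?I" for t
    using flow that by (simp add: contracting_flow_def)
  have C3: "Ck_on 3 ?I s" using flow by (simp add: contracting_flow_def s_def)
  then obtain s\<^sub>\<theta> s\<^sub>t where
    s\<^sub>\<theta>: "\<And>\<theta> t. t \<in> ?I \<Longrightarrow> ((\<lambda>\<theta>. s \<theta> t) has_real_derivative s\<^sub>\<theta> \<theta> t) (at \<theta>)"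
    and s\<^sub>t: "\<And>\<theta> t. t \<in> ?I \<Longrightarrow> (s \<theta> has_real_derivative s\<^sub>t \<theta> t) (at t within ?I)"
    and C2: "Ck_on 2 ?I s\<^sub>\<theta>" "Ck_on 2 ?I s\<^sub>t"
    unfolding numeral_3_eq_3 numeral_2_eq_2 Ck_on.simps(2)[of "Suc (Suc 0)"] by blast
  obtain s\<^sub>\<theta>\<^sub>\<theta> where
    s\<^sub>\<theta>\<^sub>\<theta>: "\<And>\<theta> t. t \<in> ?I \<Longrightarrow> ((\<lambda>\<theta>. s\<^sub>\<theta> \<theta> t) has_real_derivative s\<^sub>\<theta>\<^sub>\<theta> \<theta> t) (at \<theta>)"
    and C_\<theta>\<theta>: "Ck_on 1 ?I s\<^sub>\<theta>\<^sub>\<theta>"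
    using C2(1) unfolding numeral_2_eq_2 Ck_on.simps(2)[of "Suc 0"] One_nat_def by blast
  obtain s\<^sub>t\<^sub>\<theta> where
    s\<^sub>t\<^sub>\<theta>: "\<And>\<theta> t. t \<in> ?I \<Longrightarrow> ((\<lambda>\<theta>. s\<^sub>t \<theta> t) has_real_derivative s\<^sub>t\<^sub>\<theta> \<theta> t) (at \<theta>)"
    and C_t\<theta>: "Ck_on 1 ?I s\<^sub>t\<^sub>\<theta>"
    using C2(2) unfolding numeral_2_eq_2 Ck_on.simps(2)[of "Suc 0"] One_nat_def by blast
  obtain s\<^sub>t\<^sub>\<theta>\<^sub>\<theta> where
    s\<^sub>t\<^sub>\<theta>\<^sub>\<theta>: "\<And>\<theta> t. t \<in> ?I \<Longrightarrow> ((\<lambda>\<theta>. s\<^sub>t\<^sub>\<theta> \<theta> t) has_real_derivative s\<^sub>t\<^sub>\<theta>\<^sub>\<theta> \<theta> t) (at \<theta>)"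
    and C_t\<theta>\<theta>: "Ck_on 0 ?I s\<^sub>t\<^sub>\<theta>\<^sub>\<theta>"
    using C_t\<theta> unfolding Ck_on.simps(2)[of 0] One_nat_def by blast
  note cont = C3[THEN Ck_on_continuous] C2[THEN Ck_on_continuous] C_\<theta>\<theta>[THEN Ck_on_continuous]
    C_t\<theta>[THEN Ck_on_continuous] C_t\<theta>\<theta>[THEN Ck_on_continuous]
  have F: "s\<^sub>t \<theta> t = - F \<theta> t" if t: "t \<in> ?I" for \<theta> t
  proof (rule has_real_derivative_unique_Ico[OF s\<^sub>t[OF t] _ t])
    show "(s \<theta> has_real_derivative - F \<theta> t) (at t within ?I)"
      using flow t unfolding contracting_flow_def F_def s_def r_def m_def by simp
  qed
  have r: "r \<theta> t = s\<^sub>\<theta>\<^sub>\<theta> \<theta> t + s \<theta> t" if t: "t \<in> ?I" for \<theta> t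
  proof -
    obtain s' where s': "\<And>\<theta>. (support (K t) has_real_derivative s' \<theta>) (at \<theta>)"
      "\<And>\<theta>. (s' has_real_derivative curv_radius (K t) \<theta> - support (K t) \<theta>) (at \<theta>)"
      using K_sym_geometry[OF K[OF t]] by metis
    have "s' = (\<lambda>\<theta>. s\<^sub>\<theta> \<theta> t)"
      using DERIV_unique[OF s'(1)] s\<^sub>\<theta>[OF t] unfolding s_def by blast
    then have "r \<theta> t - s \<theta> t = s\<^sub>\<theta>\<^sub>\<theta> \<theta> t"
      using DERIV_unique[OF s'(2)] s\<^sub>\<theta>\<^sub>\<theta>[OF t] unfolding s_def r_def by blast
    then show ?thesis by simp
  qed
  have s\<^sub>\<theta>\<^sub>t: "(s\<^sub>\<theta> \<theta> has_real_derivative s\<^sub>t\<^sub>\<theta> \<theta> t) (at t within ?I)" if "t \<in> ?I" for \<theta> t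
    by (rule mixed_partial_derivative[OF s\<^sub>t s\<^sub>\<theta> s\<^sub>t\<^sub>\<theta> cont(3,5) that])
  have s\<^sub>\<theta>\<^sub>\<theta>\<^sub>t: "(s\<^sub>\<theta>\<^sub>\<theta> \<theta> has_real_derivative s\<^sub>t\<^sub>\<theta>\<^sub>\<theta> \<theta> t) (at t within ?I)" if "t \<in> ?I" for \<theta> t
    by (rule mixed_partial_derivative[OF s\<^sub>\<theta>\<^sub>t s\<^sub>\<theta>\<^sub>\<theta> s\<^sub>t\<^sub>\<theta>\<^sub>\<theta> cont(5,6) that])
  show ?thesis
  proof (rule that[of "\<lambda>\<theta> t. - s\<^sub>t\<^sub>\<theta> \<theta> t" "\<lambda>\<theta> t. - s\<^sub>t\<^sub>\<theta>\<^sub>\<theta> \<theta> t"])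
    fix \<theta> t assume t: "t \<in> ?I"
    have "(\<lambda>\<theta>. F \<theta> t) = (\<lambda>\<theta>. - s\<^sub>t \<theta> t)" using F[OF t] by simp
    then show "((\<lambda>\<theta>. F \<theta> t) has_real_derivative - s\<^sub>t\<^sub>\<theta> \<theta> t) (at \<theta>)"
      using DERIV_minus[OF s\<^sub>t\<^sub>\<theta>[OF t]] by simp
    show "((\<lambda>\<theta>. - s\<^sub>t\<^sub>\<theta> \<theta> t) has_real_derivative - s\<^sub>t\<^sub>\<theta>\<^sub>\<theta> \<theta> t) (at \<theta>)"
      by (rule DERIV_minus[OF s\<^sub>t\<^sub>\<theta>\<^sub>\<theta>[OF t]])
    show "(s \<theta> has_real_derivative - F \<theta> t) (at t within ?I)"
      using s\<^sub>t[OF t] F[OF t] by simp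
    have "((\<lambda>t. s\<^sub>\<theta>\<^sub>\<theta> \<theta> t + s \<theta> t) has_real_derivative - (- s\<^sub>t\<^sub>\<theta>\<^sub>\<theta> \<theta> t + F \<theta> t)) (at t within ?I)"
      using DERIV_add[OF s\<^sub>\<theta>\<^sub>\<theta>\<^sub>t[OF t] s\<^sub>t[OF t]] F[OF t] by simp
    then show "(r \<theta> has_real_derivative - (- s\<^sub>t\<^sub>\<theta>\<^sub>\<theta> \<theta> t + F \<theta> t)) (at t within ?I)"
      by (rule has_field_derivative_transform_within[OF _ zero_less_one t]) (simp add: r)
  next
    show "continuous_on (UNIV \<times> ?I) (\<lambda>(\<theta>, t). s \<theta> t)" by (rule cont)
    have "continuous_on (UNIV \<times> ?I) (\<lambda>(\<theta>, t). s\<^sub>\<theta>\<^sub>\<theta> \<theta> t + s \<theta> t)"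
      using continuous_on_add[OF cont(4,1)] by (simp add: case_prod_beta')
    then show "continuous_on (UNIV \<times> ?I) (\<lambda>(\<theta>, t). r \<theta> t)"
      by (rule continuous_on_eq) (auto simp: r)
    show "continuous_on (UNIV \<times> ?I) (\<lambda>(\<theta>, t). - s\<^sub>t\<^sub>\<theta>\<^sub>\<theta> \<theta> t)"
      using continuous_on_minus[OF cont(6)] by (simp add: case_prod_beta')
  qed
qed

lemma continuous_on_time_angle:
  fixes g :: "real \<Rightarrow> real \<Rightarrow> real"
  assumes "continuous_on (UNIV \<times> I) (\<lambda>(\<theta>, t). g \<theta> t)"
  shows "continuous_on (I \<times> S) (\<lambda>x. g (snd x) (fst x))"
proof -
  have "continuous_on (I \<times> S) (\<lambda>x. (\<lambda>(\<theta>, t). g \<theta> t) (snd x, fst x))"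
    by (rule continuous_on_compose2[OF assms]) (auto intro!: continuous_intros)
  then show ?thesis by simp
qed

text \<open>\<open>\<Omega>\<^sub>p = \<integral> s\<^sup>1\<^sup>-\<^sup>3\<^sup>m r\<^sup>1\<^sup>-\<^sup>m\<close> is differentiated under the integral sign with \<open>s\<^sub>t = - F\<close> and
  \<open>r\<^sub>t = - (F\<^sub>\<theta>\<^sub>\<theta> + F)\<close>.\<close>

lemma Omega_derivative:
  fixes p T t :: real and K :: "real \<Rightarrow> (real^2) set"
  assumes flow: "contracting_flow p T K" and t: "t \<in> {0..<T}"
    and m_def: "m = p / (p + 2)"
    and s_def: "s = support (K t)" and r_def: "r = curv_radius (K t)"
    and F_def: "F = (\<lambda>\<theta>. s \<theta> powr (1 - 3 * m) * r \<theta> powr (- m))"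
  shows "\<exists>F\<^sub>\<theta> F\<^sub>\<theta>\<^sub>\<theta>.
    (\<forall>\<theta>. (F has_real_derivative F\<^sub>\<theta> \<theta>) (at \<theta>)) \<and>
    (\<forall>\<theta>. (F\<^sub>\<theta> has_real_derivative F\<^sub>\<theta>\<^sub>\<theta> \<theta>) (at \<theta>)) \<and>
    continuous_on UNIV F\<^sub>\<theta>\<^sub>\<theta> \<and>
    ((\<lambda>\<tau>. Omega p (K \<tau>)) has_real_derivative
       integral {0..2*pi} (\<lambda>\<theta>. (3 * m - 1) * ((F \<theta>)\<^sup>2 * r \<theta> / s \<theta>)
         - (1 - m) * (F \<theta> * (F\<^sub>\<theta>\<^sub>\<theta> \<theta> + F \<theta>)))) (at t within {0..<T})"
proof -
  let ?I = "{0..<T}"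
  define S where "S = (\<lambda>\<theta> t. support (K t) \<theta>)"
  define R where "R = (\<lambda>\<theta> t. curv_radius (K t) \<theta>)"
  define G where "G = (\<lambda>\<theta> t. S \<theta> t powr (1 - 3 * m) * R \<theta> t powr (- m))"
  obtain G\<^sub>\<theta> G\<^sub>\<theta>\<^sub>\<theta> where
    G1: "\<And>\<theta> t. t \<in> ?I \<Longrightarrow> ((\<lambda>\<theta>. G \<theta> t) has_real_derivative G\<^sub>\<theta> \<theta> t) (at \<theta>)" and
    G2: "\<And>\<theta> t. t \<in> ?I \<Longrightarrow> ((\<lambda>\<theta>. G\<^sub>\<theta> \<theta> t) has_real_derivative G\<^sub>\<theta>\<^sub>\<theta> \<theta> t) (at \<theta>)" and
    S_t: "\<And>\<theta> t. t \<in> ?I \<Longrightarrow> (S \<theta> has_real_derivative - G \<theta> t) (at t within ?I)" and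
    R_t: "\<And>\<theta> t. t \<in> ?I \<Longrightarrow> (R \<theta> has_real_derivative - (G\<^sub>\<theta>\<^sub>\<theta> \<theta> t + G \<theta> t)) (at t within ?I)" and
    cont: "continuous_on (UNIV \<times> ?I) (\<lambda>(\<theta>, t). S \<theta> t)"
    "continuous_on (UNIV \<times> ?I) (\<lambda>(\<theta>, t). R \<theta> t)"
    "continuous_on (UNIV \<times> ?I) (\<lambda>(\<theta>, t). G\<^sub>\<theta>\<^sub>\<theta> \<theta> t)"
    using contracting_flow_evolution[OF flow m_def S_def R_def G_def] by metis
  have K: "K \<tau> \<in> K_sym" if "\<tau> \<in> ?I" for \<tau>
    using flow that by (simp add: contracting_flow_def)
  have pos: "S \<theta> \<tau> > 0" "R \<theta> \<tau> > 0" if "\<tau> \<in> ?I" for \<theta> \<tau>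
  proof -
    show "S \<theta> \<tau> > 0" using support_pos[OF K[OF that]] by (simp add: S_def)
    show "R \<theta> \<tau> > 0" unfolding R_def using K_sym_geometry[OF K[OF that]] by blast
  qed
  have eqs: "s \<theta> = S \<theta> t" "r \<theta> = R \<theta> t" "F \<theta> = G \<theta> t" for \<theta>
    by (simp_all add: s_def r_def F_def S_def R_def G_def)
  define h where "h \<tau> \<theta> = S \<theta> \<tau> powr (1 - 3 * m) * R \<theta> \<tau> powr (1 - m)" for \<tau> \<theta>
  define h' where "h' \<tau> \<theta> = (3 * m - 1) * ((G \<theta> \<tau>)\<^sup>2 * R \<theta> \<tau> / S \<theta> \<tau>)
    - (1 - m) * (G \<theta> \<tau> * (G\<^sub>\<theta>\<^sub>\<theta> \<theta> \<tau> + G \<theta> \<tau>))" for \<tau> \<theta>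
  have hG: "h \<tau> \<theta> = G \<theta> \<tau> * R \<theta> \<tau>" if "\<tau> \<in> ?I" for \<tau> \<theta>
    using pos[OF that, of \<theta>] powr_add[of "R \<theta> \<tau>" "-m" 1] by (simp add: h_def G_def)
  have Omega: "Omega p (K \<tau>) = integral (cbox 0 (2*pi)) (h \<tau>)" if "\<tau> \<in> ?I" for \<tau>
  proof -
    have "h \<tau> = (\<lambda>\<theta>. G \<theta> \<tau> * R \<theta> \<tau>)" using hG[OF that] by blast
    then show ?thesis
      unfolding Omega_def Omega_integrand[OF K[OF that]] by (simp add: G_def S_def R_def m_def)
  qed
  note c = cont[THEN continuous_on_time_angle]
  have nz: "\<forall>x\<in>?I \<times> cbox 0 (2*pi). S (snd x) (fst x) \<noteq> 0" "\<forall>x\<in>?I \<times> cbox 0 (2*pi). R (snd x) (fst x) \<noteq> 0"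
    by (metis mem_Times_iff pos(1) less_irrefl, metis mem_Times_iff pos(2) less_irrefl)
  have ch: "continuous_on (?I \<times> cbox 0 (2*pi)) (\<lambda>x. h (fst x) (snd x))"
    unfolding h_def by (intro continuous_intros c nz)
  have ch': "continuous_on (?I \<times> cbox 0 (2*pi)) (\<lambda>(\<tau>, \<theta>). h' \<tau> \<theta>)"
    unfolding h'_def G_def case_prod_beta by (intro continuous_intros c nz)
  have "((\<lambda>\<tau>. integral (cbox 0 (2*pi)) (h \<tau>)) has_real_derivative integral (cbox 0 (2*pi)) (h' t))
      (at t within ?I)"
  proof (rule leibniz_rule_field_derivative[OF _ _ ch' t])
    fix \<tau> \<theta> assume \<tau>: "\<tau> \<in> ?I"
    note P = pos[OF \<tau>, of \<theta>]
    have "((\<lambda>\<tau>. h \<tau> \<theta>) has_real_derivative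
        (1 - 3 * m) * S \<theta> \<tau> powr (1 - 3 * m - 1) * (- G \<theta> \<tau>) * R \<theta> \<tau> powr (1 - m)
        + S \<theta> \<tau> powr (1 - 3 * m) * ((1 - m) * R \<theta> \<tau> powr (1 - m - 1) * (- (G\<^sub>\<theta>\<^sub>\<theta> \<theta> \<tau> + G \<theta> \<tau>)))) (at \<tau> within ?I)"
      unfolding h_def using P by (auto intro!: derivative_eq_intros S_t[OF \<tau>] R_t[OF \<tau>])
    then show "((\<lambda>\<tau>. h \<tau> \<theta>) has_real_derivative h' \<tau> \<theta>) (at \<tau> within ?I)"
    proof (rule DERIV_cong)
      have 1: "S \<theta> \<tau> powr (1 - 3 * m - 1) = S \<theta> \<tau> powr (1 - 3 * m) / S \<theta> \<tau>"
        using P by (subst powr_diff) simp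
      have 2: "R \<theta> \<tau> powr (1 - m) = R \<theta> \<tau> powr (- m) * R \<theta> \<tau>"
        using P powr_add[of "R \<theta> \<tau>" "-m" 1] by simp
      show "(1 - 3 * m) * S \<theta> \<tau> powr (1 - 3 * m - 1) * (- G \<theta> \<tau>) * R \<theta> \<tau> powr (1 - m)
        + S \<theta> \<tau> powr (1 - 3 * m) * ((1 - m) * R \<theta> \<tau> powr (1 - m - 1) * (- (G\<^sub>\<theta>\<^sub>\<theta> \<theta> \<tau> + G \<theta> \<tau>))) = h' \<tau> \<theta>"
        unfolding 1 2 h'_def using P by (simp add: G_def power2_eq_square field_simps)
    qed
  next
    fix \<tau> assume \<tau>: "\<tau> \<in> ?I"
    have "continuous_on (cbox 0 (2*pi)) (\<lambda>\<theta>. (\<lambda>x. h (fst x) (snd x)) (\<tau>, \<theta>))"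
      by (rule continuous_on_compose2[OF ch]) (use \<tau> in \<open>auto intro!: continuous_intros\<close>)
    then show "h \<tau> integrable_on cbox 0 (2*pi)" by (simp add: integrable_continuous_interval)
  qed simp
  then have "((\<lambda>\<tau>. Omega p (K \<tau>)) has_real_derivative integral (cbox 0 (2*pi)) (h' t)) (at t within ?I)"
    by (rule has_field_derivative_transform_within[OF _ zero_less_one t]) (simp add: Omega)
  moreover have "F = (\<lambda>\<theta>. G \<theta> t)" using eqs by blast
  moreover have "continuous_on UNIV (\<lambda>\<theta>. (\<lambda>(\<theta>, t). G\<^sub>\<theta>\<^sub>\<theta> \<theta> t) (\<theta>, t))"
    by (rule continuous_on_compose2[OF cont(3)]) (use t in \<open>auto intro!: continuous_intros\<close>)
  moreover have "h' t = (\<lambda>\<theta>. (3 * m - 1) * ((F \<theta>)\<^sup>2 * r \<theta> / s \<theta>)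
      - (1 - m) * (F \<theta> * (G\<^sub>\<theta>\<^sub>\<theta> \<theta> t + F \<theta>)))"
    by (auto simp: h'_def eqs)
  ultimately show ?thesis
    using G1[OF t] G2[OF t]
    by - (rule exI[of _ "\<lambda>\<theta>. G\<^sub>\<theta> \<theta> t"], rule exI[of _ "\<lambda>\<theta>. G\<^sub>\<theta>\<^sub>\<theta> \<theta> t"], simp)
qed

section \<open>The differential inequality for the affine length\<close>

theorem theorem3p3:
  fixes p T t :: real and K :: "real \<Rightarrow> (real^2) set"
  assumes "p \<ge> 1"
    and "contracting_flow p T K"
    and "t \<in> {0..<T}"
  defines "\<gamma> \<equiv> gauss_param (K t)"
  defines "\<sigma> \<equiv> affine_support \<gamma>"
  shows "\<exists>D. ((\<lambda>\<tau>. Omega p (K \<tau>)) has_real_derivative D) (at t within {0..<T}) \<and>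
    (p \<le> 2 \<longrightarrow>
      D \<ge> (p - 2) / (p + 2) * ((Omega p (K t))\<^sup>2 / area (K t)) +
          18 * (p - 1) * p\<^sup>2 / (p + 2) ^ 3 *
          affine_integral \<gamma> (\<lambda>u. \<sigma> u powr (- 6 * p / (p + 2)) * (affine_deriv \<gamma> \<sigma> u)\<^sup>2)) \<and>
    (p \<ge> 2 \<longrightarrow>
      D \<ge> (p - 2) / (p + 2) * ((Omega p (K t))\<^sup>2 / area (K t)) +
          18 * p\<^sup>2 / (p + 2) ^ 3 *
          affine_integral \<gamma> (\<lambda>u. \<sigma> u powr (- 6 * p / (p + 2)) * (affine_deriv \<gamma> \<sigma> u)\<^sup>2))"
proof -
  define m where "m = p / (p + 2)"
  define s where "s = support (K t)"
  define r where "r = curv_radius (K t)"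
  define F where "F = (\<lambda>\<theta>. s \<theta> powr (1 - 3 * m) * r \<theta> powr (- m))"
  have p: "p > 0" using assms(1) by simp
  have K: "K t \<in> K_sym" using assms(2,3) by (simp add: contracting_flow_def)
  obtain F' F'' where F': "\<And>\<theta>. (F has_real_derivative F' \<theta>) (at \<theta>)"
    and F'': "\<And>\<theta>. (F' has_real_derivative F'' \<theta>) (at \<theta>)"
    and cF'': "continuous_on UNIV F''"
    and D: "((\<lambda>\<tau>. Omega p (K \<tau>)) has_real_derivative
       integral {0..2*pi} (\<lambda>\<theta>. (3 * m - 1) * ((F \<theta>)\<^sup>2 * r \<theta> / s \<theta>) - (1 - m) * (F \<theta> * (F'' \<theta> + F \<theta>))))
     (at t within {0..<T})"
    using Omega_derivative[OF assms(2,3) m_def s_def r_def F_def] by blast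
  obtain s' r' where s': "\<And>\<theta>. (s has_real_derivative s' \<theta>) (at \<theta>)"
    and s'': "\<And>\<theta>. (s' has_real_derivative r \<theta> - s \<theta>) (at \<theta>)"
    and r': "\<And>\<theta>. (r has_real_derivative r' \<theta>) (at \<theta>)" and r: "\<And>\<theta>. r \<theta> > 0"
    using K_sym_geometry[OF K, folded s_def r_def] by metis
  have s: "s \<theta> > 0" for \<theta> using support_pos[OF K] by (simp add: s_def)
  have s_per: "s (\<theta> + pi) = s \<theta>" for \<theta> using support_symmetric[OF K] by (simp add: s_def)
  have "r (\<theta> + pi) = r \<theta>" for \<theta>
    using DERIV_periodic[where f = s', OF s'' DERIV_periodic[where f = s, OF s' s_per], of \<theta>] s_per by simp
  then have F_per: "F (\<theta> + pi) = F \<theta>" for \<theta> by (simp add: F_def s_per)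
  have cs: "continuous_on UNIV s" "continuous_on UNIV r" "continuous_on UNIV F"
    by (fact DERIV_continuous_on[OF s'] DERIV_continuous_on[OF r'] DERIV_continuous_on[OF F'])+
  have s0: "s x \<noteq> 0" and r0: "r x \<noteq> 0" for x using s[of x] r[of x] by simp_all
  define J where "J = integral {0..2*pi} (\<lambda>x. (F x)\<^sup>2 * r x / s x)"
  define P where "P = integral {0..2*pi} (\<lambda>x. (F' x - F x * s' x / s x)\<^sup>2)"
  define B where "B = integral {0..2*pi} (\<lambda>x. s x * r x)"
  define W where "W = integral {0..2*pi} (\<lambda>x. F x * r x)"
  note energy = energy_identities[OF s' s'' F' F'' cs(2) cF'' s_per F_per s, folded J_def P_def]
  have "((\<lambda>\<theta>. (3 * m - 1) * ((F \<theta>)\<^sup>2 * r \<theta> / s \<theta>) - (1 - m) * (F \<theta> * (F'' \<theta> + F \<theta>)))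
      has_integral (3 * m - 1) * J - (1 - m) * (J - P)) {0..2*pi}"
    unfolding energy(2)[symmetric] unfolding J_def
    by (intro has_integral_diff has_integral_mult_right integrable_integral
        continuous_UNIV_integrable continuous_intros cs cF'' ballI s0)
  from D[unfolded integral_unique[OF this]] have D: "((\<lambda>\<tau>. Omega p (K \<tau>)) has_real_derivative (1 - m) * P + (4 * m - 2) * J) (at t within {0..<T})"
    by (simp add: algebra_simps)
  have W: "Omega p (K t) = W"
    unfolding Omega_def W_def using Omega_integrand[OF K, of _ p]
    by (simp add: F_def s_def r_def m_def)
  have area: "area (K t) = B / 2"
    unfolding area_def B_def by (simp add: s_def r_def curv_radius_def)
  have B: "B > 0"
  proof -
    have "B \<noteq> 0"
      unfolding B_def
      by (subst integral_eq_0_iff) (auto intro!: continuous_intros continuous_on_subset[OF cs(1)]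
          continuous_on_subset[OF cs(2)] simp: s0 r0 s[THEN less_imp_le] r[THEN less_imp_le])
    moreover have "B \<ge> 0" unfolding B_def
      by (intro integral_nonneg continuous_UNIV_integrable continuous_intros cs)
        (simp add: s[THEN less_imp_le] r[THEN less_imp_le])
    ultimately show ?thesis by simp
  qed
  have CS: "W\<^sup>2 \<le> J * B"
    unfolding W_def J_def B_def by (rule cauchy_schwarz_weighted[OF cs s r])
  have mink: "(J - P) * B \<le> W\<^sup>2"
    using minkowski_symmetric[OF s' s'' F' _ _ s_per F_per s0] energy(1) B
      DERIV_continuous_on[OF F''] cs
    by (simp add: B_def W_def continuous_intros)
  have P: "9 * m\<^sup>2 * affine_integral \<gamma> (\<lambda>u. \<sigma> u powr (- 6 * p / (p + 2)) * (affine_deriv \<gamma> \<sigma> u)\<^sup>2) = P"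
    unfolding \<sigma>_def \<gamma>_def P_def
    using affine_integral_eq[OF K, folded s_def r_def, OF s' F' F_def]
    by (simp add: m_def s_def)
  define e where "e = 2 / (p + 2)"
  have e: "e > 0" using p by (simp add: e_def)
  have c1: "1 - m = e" and c2: "4 * m - 2 = e * (p - 2)"
    using p by (simp_all add: m_def e_def field_simps)
  let ?A = "affine_integral \<gamma> (\<lambda>u. \<sigma> u powr (- 6 * p / (p + 2)) * (affine_deriv \<gamma> \<sigma> u)\<^sup>2)"
  have coeff: "18 * p\<^sup>2 / (p + 2) ^ 3 * ?A = e * P"
  proof -
    have "18 * p\<^sup>2 / (p + 2) ^ 3 * a = 2 / (p + 2) * (9 * m\<^sup>2 * a)" for a :: real
      by (simp add: m_def power_divide power2_eq_square power3_eq_cube mult_ac)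
    then show ?thesis unfolding P[symmetric] e_def .
  qed
  have ratio: "(p - 2) / (p + 2) * (W\<^sup>2 / (B / 2)) = e * (p - 2) * (W\<^sup>2 / B)"
    by (simp add: e_def)
  show ?thesis
  proof (intro exI[of _ "(1 - m) * P + (4 * m - 2) * J"] conjI impI D)
    \<comment> \<open>Here \<open>4 m - 2 \<le> 0\<close>, so \<open>J\<close> needs an upper bound: the share \<open>2 - p\<close> of \<open>P\<close> is
      spent on Minkowski's inequality and the share \<open>p - 1\<close> remains.\<close>
    assume "p \<le> 2"
    have "J - P \<le> W\<^sup>2 / B" using mink B by (simp add: field_simps)
    then have "0 \<le> e * (2 - p) * (P - J + W\<^sup>2 / B)"
      using \<open>p \<le> 2\<close> e by (intro mult_nonneg_nonneg) auto
    moreover have "18 * (p - 1) * p\<^sup>2 / (p + 2) ^ 3 * ?A = (p - 1) * (e * P)"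
      unfolding coeff[symmetric] by simp
    ultimately show "(p - 2) / (p + 2) * ((Omega p (K t))\<^sup>2 / area (K t))
        + 18 * (p - 1) * p\<^sup>2 / (p + 2) ^ 3 * ?A \<le> (1 - m) * P + (4 * m - 2) * J"
      unfolding W area ratio c1 c2 by (simp add: algebra_simps)
  next
    \<comment> \<open>Here \<open>4 m - 2 \<ge> 0\<close>, so the lower bound for \<open>J\<close> suffices and all of \<open>P\<close> is kept.\<close>
    assume "p \<ge> 2"
    have "W\<^sup>2 / B \<le> J" using CS B by (simp add: field_simps)
    then have "e * (p - 2) * (W\<^sup>2 / B) \<le> e * (p - 2) * J"
      using \<open>p \<ge> 2\<close> e by (intro mult_left_mono) auto
    then show "(p - 2) / (p + 2) * ((Omega p (K t))\<^sup>2 / area (K t))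
        + 18 * p\<^sup>2 / (p + 2) ^ 3 * ?A \<le> (1 - m) * P + (4 * m - 2) * J"
      unfolding W area ratio c1 c2 coeff by simp
  qed
qed

end
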